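(* Let $P_T(x,y,z) = x^3+2x^2y+x^2z+2xy^2-2xyz-xz^2+2y^3-2yz^2+z^3$, and let $(T_n)_{n\in\mathbb{Z}}$ be the Tribonacci numbers defined by $T_0 = T_1 = 0$, $T_2 = 1$, and $T_n = T_{n-1}+T_{n-2}+T_{n-3}$ for all integers $n$ (so that for negative indices $T_n = T_{n+3} - T_{n+2} - T_{n+1}$). If $x, y, z$ are integers with $P_T(x,y,z) = 1$, then $(x,y,z) = (T_n, T_{n+1}, T_{n+2})$ for some integer $n$. *)

theory Defs
  imports Main
begin

definition P_T :: "int \<Rightarrow> int \<Rightarrow> int \<Rightarrow> int" where
  "P_T x y z = x^3 + 2*x^2*y + x^2*z + 2*x*y^2 - 2*x*y*z - x*z^2 + 2*y^3 - 2*y*z^2 + z^3"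

function tribonacci :: "int \<Rightarrow> int" where
  "tribonacci n =
    (if n < 0 then tribonacci (n + 3) - tribonacci (n + 2) - tribonacci (n + 1)
     else if n = 0 \<or> n = 1 then 0
     else if n = 2 then 1
     else tribonacci (n - 1) + tribonacci (n - 2) + tribonacci (n - 3))"
  by auto
termination
  by (relation "measure (\<lambda>n. if n < 0 then nat (3 - n) else nat n)") auto

declare tribonacci.simps [simp del]

lemma tribonacci_0: "tribonacci 0 = 0"
  and tribonacci_1: "tribonacci 1 = 0"
  and tribonacci_2: "tribonacci 2 = 1"
  by (simp_all add: tribonacci.simps)

lemma tribonacci_rec:
  "tribonacci n = tribonacci (n - 1) + tribonacci (n - 2) + tribonacci (n - 3)"
proof (cases "n > 2")
  case True
  then show ?thesis by (subst tribonacci.simps) simp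
next
  case False
  then have "tribonacci (n - 3) = tribonacci n - tribonacci (n - 1) - tribonacci (n - 2)"
    by (subst tribonacci.simps) simp
  then show ?thesis by simp
qed

end

theory Submission
  imports Defs Complex_Main
begin

text \<open>
  Let \<open>\<alpha>\<close> be the real root of \<open>t^3 = t^2 + t + 1\<close> and \<open>\<beta>\<close> a complex root. The form \<open>P_T\<close> is the
  norm of the linear form \<open>L(\<alpha>) = z + (\<alpha> - 1) y + x / \<alpha>\<close>, so \<open>P_T = L(\<alpha>) |L(\<beta>)|^2\<close>. The
  Tribonacci shift \<open>(x, y, z) \<mapsto> (y, z, x + y + z)\<close> preserves \<open>P_T\<close> and multiplies \<open>L(\<alpha>)\<close> by \<open>\<alpha>\<close>;
  hence every solution of \<open>P_T = 1\<close> can be shifted to one with \<open>1 \<le> L(\<alpha>) < \<alpha>\<close>. Then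
  \<open>|L(\<beta>)|^2 \<le> 1\<close>, which bounds \<open>x\<close>, \<open>y\<close> and \<open>z\<close> and leaves only \<open>(0, 0, 1)\<close>.
\<close>

definition trib_triple :: "int \<Rightarrow> int \<Rightarrow> int \<Rightarrow> bool" where
  "trib_triple x y z \<longleftrightarrow>
    (\<exists>n. (x, y, z) = (tribonacci n, tribonacci (n + 1), tribonacci (n + 2)))"

lemma trib_triple_0_0_1: "trib_triple 0 0 1"
  unfolding trib_triple_def
  by (rule exI[of _ 0]) (simp add: tribonacci_0 tribonacci_1 tribonacci_2)

text \<open>The index moves by one in either direction; since it ranges over all integers, the shift
  can also be undone.\<close>

lemma trib_triple_shift_iff: "trib_triple y z (x + y + z) \<longleftrightarrow> trib_triple x y z"
proof
  assume "trib_triple y z (x + y + z)"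
  then obtain n where n: "y = tribonacci n" "z = tribonacci (n + 1)"
      "x + y + z = tribonacci (n + 2)"
    unfolding trib_triple_def by auto
  have "x = tribonacci (n - 1)"
    using n tribonacci_rec[of "n + 2"] by (simp add: add.commute)
  then show "trib_triple x y z"
    unfolding trib_triple_def using n by (intro exI[of _ "n - 1"]) (simp add: add.commute)
next
  assume "trib_triple x y z"
  then obtain n where n: "x = tribonacci n" "y = tribonacci (n + 1)" "z = tribonacci (n + 2)"
    unfolding trib_triple_def by auto
  have "x + y + z = tribonacci (n + 3)"
    using n tribonacci_rec[of "n + 3"] by (simp add: add.commute)
  then show "trib_triple y z (x + y + z)"
    unfolding trib_triple_def using n by (intro exI[of _ "n + 1"]) (simp add: add.assoc)
qed

lemma P_T_shift: "P_T y z (x + y + z) = P_T x y z"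
  unfolding P_T_def by algebra

lemma ex_trib_const: "\<exists>\<alpha>::real. \<alpha>^3 = \<alpha>^2 + \<alpha> + 1 \<and> 1.83 < \<alpha> \<and> \<alpha> < 1.84"
proof -
  let ?f = "\<lambda>t::real. t^3 - t^2 - t - 1"
  have "\<exists>t\<ge>1.83. t \<le> 1.84 \<and> ?f t = 0"
    by (rule IVT) (auto simp: power3_eq_cube power2_eq_square intro!: continuous_intros)
  then obtain t where t: "1.83 \<le> t" "t \<le> 1.84" "?f t = 0"
    by blast
  have "?f 1.83 \<noteq> 0" "?f 1.84 \<noteq> 0"
    by (simp_all add: power3_eq_cube power2_eq_square)
  then have "t \<noteq> 1.83" "t \<noteq> 1.84"
    using t(3) by metis+
  then show ?thesis
    using t by (intro exI[of _ t]) auto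
qed

text \<open>The coefficient of \<open>x\<close> is \<open>1 / \<alpha> = \<alpha>^2 - \<alpha> - 1\<close>.\<close>

definition trib_form :: "real \<Rightarrow> int \<Rightarrow> int \<Rightarrow> int \<Rightarrow> real" where
  "trib_form \<alpha> x y z = z + (\<alpha> - 1) * y + (\<alpha>^2 - \<alpha> - 1) * x"

text \<open>Real and imaginary part of \<open>z + (\<beta> - 1) y + x / \<beta>\<close>, the latter divided by \<open>Im \<beta>\<close>.\<close>

definition trib_re :: "real \<Rightarrow> int \<Rightarrow> int \<Rightarrow> int \<Rightarrow> real" where
  "trib_re \<alpha> x y z = z - (\<alpha> + 1) / 2 * y - \<alpha> * (\<alpha> - 1) / 2 * x"

definition trib_im :: "real \<Rightarrow> int \<Rightarrow> int \<Rightarrow> real" where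
  "trib_im \<alpha> x y = y - \<alpha> * x"

context
  fixes \<alpha> :: real
  assumes root: "\<alpha>^3 = \<alpha>^2 + \<alpha> + 1" and lower: "1.83 < \<alpha>" and upper: "\<alpha> < 1.84"
begin

lemma trib_form_shift: "trib_form \<alpha> y z (x + y + z) = \<alpha> * trib_form \<alpha> x y z"
  unfolding trib_form_def of_int_add using root by algebra

text \<open>The constant \<open>\<alpha>^2 - \<alpha> - 1 - (\<alpha> - 1)^2 / 4\<close> is \<open>(Im \<beta>)^2 = |\<beta>|^2 - (Re \<beta>)^2\<close>.\<close>

lemma P_T_factorization:
  "of_int (P_T x y z) = trib_form \<alpha> x y z *
     ((trib_re \<alpha> x y z)^2 + (\<alpha>^2 - \<alpha> - 1 - (\<alpha> - 1)^2 / 4) * (trib_im \<alpha> x y)^2)"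
proof -
  \<comment> \<open>Doubling the real part clears the halves, so that \<open>algebra\<close> only
    has to verify a polynomial identity modulo the cubic equation of \<alpha>.\<close>
  define u where "u = 2 * trib_re \<alpha> x y z"
  have u: "u = 2 * z - (\<alpha> + 1) * y - \<alpha> * (\<alpha> - 1) * x"
    unfolding u_def trib_re_def by (simp add: field_simps)
  have "4 * of_int (P_T x y z) = trib_form \<alpha> x y z *
     (u^2 + (4 * (\<alpha>^2 - \<alpha> - 1) - (\<alpha> - 1)^2) * (trib_im \<alpha> x y)^2)"
    unfolding P_T_def trib_form_def u trib_im_def of_int_add of_int_diff of_int_mult of_int_power
      of_int_numeral
    using root by algebra
  then show ?thesis
    unfolding u_def by (simp add: field_simps)
qed

text \<open>Since \<alpha>^2 - \<alpha> - 1 = 1 / \<alpha>, the value exceeds 1 / 1.84 - 0.84^2 / 4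
  > 0.36. The bound 9 / 25 is a perfect square, which later gives |w| \<le> 5 / 3.\<close>

lemma im_sq_gt: "\<alpha>^2 - \<alpha> - 1 - (\<alpha> - 1)^2 / 4 > 9 / 25"
proof -
  have "1 = \<alpha> * (\<alpha>^2 - \<alpha> - 1)"
    using root by algebra
  also have "\<dots> > 0 \<longrightarrow> \<alpha>^2 - \<alpha> - 1 > 0"
    using lower by (simp add: zero_less_mult_iff)
  finally have "\<alpha>^2 - \<alpha> - 1 > 0" by simp
  then have "\<alpha> * (\<alpha>^2 - \<alpha> - 1) \<le> 1.84 * (\<alpha>^2 - \<alpha> - 1)"
    using upper by (intro mult_right_mono) auto
  then have "\<alpha>^2 - \<alpha> - 1 \<ge> 1 / 1.84"
    using \<open>1 = \<alpha> * (\<alpha>^2 - \<alpha> - 1)\<close> by simp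
  moreover have "(\<alpha> - 1)^2 \<le> 0.84^2"
    using lower upper by (intro power_mono) auto
  ultimately show ?thesis
    by (simp add: power2_eq_square)
qed

text \<open>The cofactor in the factorization is a nonnegative quadratic form, and the product is
  1.\<close>

lemma trib_form_pos:
  assumes "P_T x y z = 1"
  shows "trib_form \<alpha> x y z > 0"
proof -
  let ?q = "(trib_re \<alpha> x y z)^2 + (\<alpha>^2 - \<alpha> - 1 - (\<alpha> - 1)^2 / 4) * (trib_im \<alpha> x y)^2"
  have "trib_form \<alpha> x y z * ?q = 1"
    using P_T_factorization[of x y z] assms by simp
  moreover have "?q \<ge> 0"
    using im_sq_gt by (intro add_nonneg_nonneg mult_nonneg_nonneg) auto
  ultimately show ?thesis
    by (metis mult_nonpos_nonneg not_le zero_less_one)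
qed

lemma fundamental_window:
  assumes P: "P_T x y z = 1" and ge: "1 \<le> trib_form \<alpha> x y z" and less: "trib_form \<alpha> x y z < \<alpha>"
  shows "(x, y, z) = (0, 0, 1)"
proof -
  define c where "c = \<alpha>^2 - \<alpha> - 1 - (\<alpha> - 1)^2 / 4"
  define L u w where "L = trib_form \<alpha> x y z" and "u = trib_re \<alpha> x y z" and "w = trib_im \<alpha> x y"
  have c: "c > 9 / 25"
    unfolding c_def by (rule im_sq_gt)
  have q0: "0 \<le> u^2 + c * w^2"
    using c by simp
  have "L * (u^2 + c * w^2) = 1"
    using P_T_factorization[of x y z] P by (simp add: c_def L_def u_def w_def)
  moreover have "1 * (u^2 + c * w^2) \<le> L * (u^2 + c * w^2)"
    using q0 ge by (intro mult_right_mono) (auto simp: L_def)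
  ultimately have q: "u^2 + c * w^2 \<le> 1"
    by simp
  have "0 \<le> c * w^2"
    using c by simp
  then have "u^2 \<le> 1"
    using q by linarith
  then have u: "-1 \<le> u" "u \<le> 1"
    by (auto simp: abs_square_le_1 abs_le_iff)
  have "9 / 25 * w^2 \<le> c * w^2"
    using c by (intro mult_right_mono) auto
  moreover have "0 \<le> u^2" by simp
  ultimately have "9 / 25 * w^2 \<le> 1"
    using q by linarith
  then have "w^2 \<le> (5 / 3)^2"
    by (simp add: power2_eq_square)
  then have w: "-(5 / 3) \<le> w" "w \<le> 5 / 3"
    by (auto dest: abs_le_square_iff[THEN iffD2])
  have \<alpha>2: "\<alpha>^2 > 1.83^2"
    using lower by (intro power_strict_mono) auto
  \<comment> \<open>L - u is free of z, and subtracting a multiple of w removes y as well. The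
    remaining coefficient of x is the derivative of t^3 - t^2 - t - 1 at \<alpha>.\<close>
  define a where "a = 3 * \<alpha>^2 - 2 * \<alpha> - 1"
  have A: "a * x = (L - u) - (3 * \<alpha> - 1) / 2 * w"
    unfolding a_def L_def u_def w_def trib_form_def trib_re_def trib_im_def
    by (simp add: field_simps power2_eq_square)
  have A5: "a > 5"
    unfolding a_def using \<alpha>2 upper by (simp add: power2_eq_square)
  have B: "\<bar>(3 * \<alpha> - 1) / 2 * w\<bar> \<le> 2.3 * (5 / 3)"
    unfolding abs_mult using w lower upper by (intro mult_mono) auto
  have lo: "a * x > -5"
    using A B ge u by (simp add: L_def[symmetric] abs_le_iff)
  have hi: "a * x < 10"
    using A B less upper u by (simp add: L_def[symmetric] abs_le_iff)
  have "x > -1"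
  proof (rule ccontr)
    assume "\<not> x > -1"
    then have "of_int x \<le> (-1::real)" by simp
    then have "a * x \<le> a * (-1)"
      using A5 by (intro mult_left_mono) auto
    then show False using lo A5 by linarith
  qed
  moreover have "x < 2"
  proof (rule ccontr)
    assume "\<not> x < 2"
    then have "of_int x \<ge> (2::real)" by simp
    then have "a * x \<ge> a * 2"
      using A5 by (intro mult_left_mono) auto
    then show False using hi A5 by linarith
  qed
  ultimately consider "x = 0" | "x = 1" by linarith
  then show ?thesis
  proof cases
    case 1
    have "of_int y < (2::real)" "of_int y > (-2::real)"
      using w by (auto simp: w_def trib_im_def 1)
    then consider "y = -1" | "y = 0" | "y = 1" by linarith
    then show ?thesis
    proof cases
      case y: 1
      \<comment> \<open>Contradiction: u \<le> 1 forces z < 0, but L \<ge> 1 forces z \<ge>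
        \<alpha>.\<close>
      show ?thesis
        using u ge lower by (simp add: 1 y u_def trib_re_def trib_form_def field_simps)
    next
      case y: 2
      have "of_int z < (2::real)" "of_int z \<ge> (1::real)"
        using less ge upper by (auto simp: 1 y trib_form_def)
      then have "z = 1" by linarith
      then show ?thesis by (simp add: 1 y)
    next
      case y: 3
      have "of_int z < (1::real)" "of_int z > (0::real)"
        using less ge upper by (auto simp: 1 y trib_form_def)
      then show ?thesis by simp
    qed
  next
    case 2
    \<comment> \<open>Contradiction: y \<ge> 1 makes L - u > 3, whereas L < \<alpha> and u \<ge> -1
      give L - u < 2.84.\<close>
    have "of_int y > (0::real)"
      using w lower by (simp add: w_def trib_im_def 2)
    then have "(3 * \<alpha> - 1) / 2 * 1 \<le> (3 * \<alpha> - 1) / 2 * y"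
      using lower by (intro mult_left_mono) auto
    moreover have "L - u = (3 * \<alpha> - 1) / 2 * y + (3 * \<alpha>^2 - 3 * \<alpha> - 2) / 2"
      by (simp add: L_def u_def trib_form_def trib_re_def 2 field_simps power2_eq_square)
    ultimately have "L - u \<ge> (3 * \<alpha>^2 - 3) / 2"
      by (simp add: field_simps)
    moreover have "\<alpha>^2 > 3"
      using \<alpha>2 by (simp add: power2_eq_square)
    moreover have "L < \<alpha>"
      using less by (simp add: L_def)
    ultimately show ?thesis
      using u upper by simp
  qed
qed

text \<open>As long as the form is at least \<alpha>, the inverse shift
  \<open>(z - y - x, x, y)\<close> divides it by \<alpha> and keeps it at least 1, so the exponent
  drops until the window is reached.\<close>

lemma trib_triple_if_form_ge_1:
  assumes "P_T x y z = 1" "1 \<le> trib_form \<alpha> x y z" "trib_form \<alpha> x y z < \<alpha> ^ Suc m"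
  shows "trib_triple x y z"
  using assms
proof (induction m arbitrary: x y z)
  case 0
  then show ?case
    using fundamental_window[of x y z] trib_triple_0_0_1 by simp
next
  case (Suc m)
  show ?case
  proof (cases "trib_form \<alpha> x y z < \<alpha>")
    case True
    then show ?thesis
      using fundamental_window[of x y z] trib_triple_0_0_1 Suc.prems by simp
  next
    case False
    have form: "trib_form \<alpha> x y z = \<alpha> * trib_form \<alpha> (z - y - x) x y"
      using trib_form_shift[of x y "z - y - x"] by simp
    have "trib_triple (z - y - x) x y"
    proof (rule Suc.IH)
      show "P_T (z - y - x) x y = 1"
        using P_T_shift[of x y "z - y - x"] Suc.prems by simp
      show "1 \<le> trib_form \<alpha> (z - y - x) x y"
        using False form lower by simp
      show "trib_form \<alpha> (z - y - x) x y < \<alpha> ^ Suc m"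
        using Suc.prems(3) form lower by simp
    qed
    then show ?thesis
      using trib_triple_shift_iff[of x y "z - y - x"] by simp
  qed
qed

text \<open>Small values of the form are raised by m forward shifts, each contributing one factor
  \<alpha>, until the form is at least 1.\<close>

lemma trib_triple_if_form_mult_ge_1:
  assumes "P_T x y z = 1" "1 \<le> \<alpha> ^ m * trib_form \<alpha> x y z"
  shows "trib_triple x y z"
  using assms
proof (induction m arbitrary: x y z)
  case 0
  obtain m where "trib_form \<alpha> x y z < \<alpha> ^ m"
    using real_arch_pow[of \<alpha>] lower by auto
  also have "\<dots> \<le> \<alpha> ^ Suc m"
    using lower by (intro power_increasing) auto
  finally show ?case
    using trib_triple_if_form_ge_1 0 by simp
next
  case (Suc m)
  have "trib_triple y z (x + y + z)"
    using Suc by (intro Suc.IH) (simp_all add: P_T_shift trib_form_shift mult_ac)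
  then show ?case
    by (simp add: trib_triple_shift_iff)
qed

lemma P_T_eq_1_imp_trib_triple:
  assumes "P_T x y z = 1"
  shows "trib_triple x y z"
proof -
  have pos: "trib_form \<alpha> x y z > 0"
    using assms by (rule trib_form_pos)
  obtain m where "1 / trib_form \<alpha> x y z < \<alpha> ^ m"
    using real_arch_pow[of \<alpha>] lower by auto
  then have "1 \<le> \<alpha> ^ m * trib_form \<alpha> x y z"
    using pos by (simp add: field_simps)
  then show ?thesis
    using assms trib_triple_if_form_mult_ge_1 by blast
qed

end

theorem theorem3p4:
  fixes x y z :: int
  assumes "P_T x y z = 1"
  shows "\<exists>n::int. (x, y, z) = (tribonacci n, tribonacci (n + 1), tribonacci (n + 2))"
  using ex_trib_const P_T_eq_1_imp_trib_triple[OF _ _ _ assms]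
  unfolding trib_triple_def by blast

end
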